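(* Let $((X_i)_{i\in N},(C_i)_{i\in N})$ be a game in choice form such that for each $x\in X$ there exists $i\in N$ with $C_i(x_{-i})\neq\emptyset$. Assume that, for each $i\in N$, the following conditions are fulfilled: (a) $X_i$ is a nonempty, convex and compact set in a Hausdorff topological vector space $E_i$, and $C_i$ is nonempty; (b) for each $x_i\in X_i$, the set $\{x_{-i}\in X_{-i}: x_i\in C_i(x_{-i})\}$ contains a relatively open subset $O_{x_i}$ of $X_{-i}$ such that $\bigcup_{x_i\in X_i}O_{x_i}=X_{-i}$ ($O_{x_i}$ may be empty for some $x_i$); (c) $C_i(x_{-i})$ is convex or empty for each $x_{-i}\in X_{-i}$. Then the game admits an equilibrium in choice.
   Context: $N=\{1,\dots,n\}$ is a finite set of players, $X=\prod_{i\in N}X_i$, $X_{-i}=\prod_{j\neq i}X_j$ (product topologies), $x_{-i}=(x_1,\dots,x_{i-1},x_{i+1},\dots,x_n)$, and $x=(x_{-i},x_i)$. A game in choice form is a double family $((X_i)_{i\in N},(C_i)_{i\in N})$, where the $X_i$ are nonempty sets and $(C_i)_{i\in N}$ is a collection of nonempty subsets of $X$. The upper section of $C_i$ through $x_{-i}$ is $C_i(x_{-i})=\{y_i\in X_i:(x_{-i},y_i)\in C_i\}$. An element $x^*\in X$ is an equilibrium in choice if $x_i^*\in C_i(x_{-i}^* )$ for every $i\in N$ for which $C_i(x_{-i}^* )\neq\emptyset$. *)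

theory Defs
  imports "HOL-Analysis.Analysis" "HOL-Algebra.Module"
begin

text \<open>
  The spaces attached to different players may be different, so a topological vector space is a
  real vector space on an explicit carrier (a module over the field of real numbers, whose unused
  \<open>mult\<close> and \<open>one\<close> components are unconstrained) together with an abstract topology on that carrier.
\<close>

definition real_ring :: "real ring" where
  "real_ring = \<lparr>carrier = UNIV, monoid.mult = (*), one = 1, zero = 0, add = (+)\<rparr>"

definition hausdorff_tvs :: "(real, 'e) module \<Rightarrow> 'e topology \<Rightarrow> bool" where
  "hausdorff_tvs E T \<longleftrightarrow>
     Module.module real_ring E \<and>
     topspace T = carrier E \<and>
     Hausdorff_space T \<and>
     continuous_map (prod_topology T T) T (\<lambda>(x, y). x \<oplus>\<^bsub>E\<^esub> y) \<and>
     continuous_map (prod_topology euclideanreal T) T (\<lambda>(a, x). a \<odot>\<^bsub>E\<^esub> x)"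

definition convex_in :: "(real, 'e) module \<Rightarrow> 'e set \<Rightarrow> bool" where
  "convex_in E S \<longleftrightarrow>
     S \<subseteq> carrier E \<and>
     (\<forall>x\<in>S. \<forall>y\<in>S. \<forall>u\<ge>0. \<forall>v\<ge>0. u + v = 1 \<longrightarrow> u \<odot>\<^bsub>E\<^esub> x \<oplus>\<^bsub>E\<^esub> v \<odot>\<^bsub>E\<^esub> y \<in> S)"

text \<open>
  Profiles are extensional functions on the player set \<open>N\<close>. A partial profile \<open>x\<^sub>-\<^sub>i\<close> is an
  extensional function on \<open>N - {i}\<close>, and \<open>(z, y)\<close> with \<open>y\<close> in place \<open>i\<close> is \<open>z(i := y)\<close>.
\<close>

definition profiles :: "'i set \<Rightarrow> ('i \<Rightarrow> 'e set) \<Rightarrow> ('i \<Rightarrow> 'e) set" where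
  "profiles N X = PiE N X"

definition partial_profiles :: "'i set \<Rightarrow> ('i \<Rightarrow> 'e set) \<Rightarrow> 'i \<Rightarrow> ('i \<Rightarrow> 'e) set" where
  "partial_profiles N X i = PiE (N - {i}) X"

definition others :: "'i set \<Rightarrow> 'i \<Rightarrow> ('i \<Rightarrow> 'e) \<Rightarrow> ('i \<Rightarrow> 'e)" where
  "others N i x = restrict x (N - {i})"

definition partial_profile_topology ::
    "'i set \<Rightarrow> ('i \<Rightarrow> 'e set) \<Rightarrow> ('i \<Rightarrow> 'e topology) \<Rightarrow> 'i \<Rightarrow> ('i \<Rightarrow> 'e) topology" where
  "partial_profile_topology N X T i =
     product_topology (\<lambda>j. subtopology (T j) (X j)) (N - {i})"

definition game_in_choice_form ::
    "'i set \<Rightarrow> ('i \<Rightarrow> 'e set) \<Rightarrow> ('i \<Rightarrow> ('i \<Rightarrow> 'e) set) \<Rightarrow> bool" where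
  "game_in_choice_form N X C \<longleftrightarrow>
     finite N \<and> (\<forall>i\<in>N. X i \<noteq> {} \<and> C i \<noteq> {} \<and> C i \<subseteq> profiles N X)"

definition upper_section ::
    "('i \<Rightarrow> 'e set) \<Rightarrow> ('i \<Rightarrow> ('i \<Rightarrow> 'e) set) \<Rightarrow> 'i \<Rightarrow> ('i \<Rightarrow> 'e) \<Rightarrow> 'e set" where
  "upper_section X C i z = {y \<in> X i. z(i := y) \<in> C i}"

definition equilibrium_in_choice ::
    "'i set \<Rightarrow> ('i \<Rightarrow> 'e set) \<Rightarrow> ('i \<Rightarrow> ('i \<Rightarrow> 'e) set) \<Rightarrow> ('i \<Rightarrow> 'e) \<Rightarrow> bool" where
  "equilibrium_in_choice N X C x \<longleftrightarrow>
     x \<in> profiles N X \<and>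
     (\<forall>i\<in>N. upper_section X C i (others N i x) \<noteq> {} \<longrightarrow>
            x i \<in> upper_section X C i (others N i x))"

end

(*
  By compactness each X_{-i} is covered by finitely many of the open sets O_y, with y ranging over
  y_{i1}, ..., y_{im}. A point s of a finite-dimensional cube, with one coordinate for each pair
  (i, j), determines simplex weights for every player (through a retraction of the cube onto the
  simplex) and hence a profile x(s) of convex combinations of the points y_{ij}. Pulling the finite
  covers back along s |-> x(s)_{-i} gives open covers of the cube, so the partitions of unity are
  taken on the cube rather than on X_{-i}. Together they map the cube to itself; at a Brouwer
  fixed point, x(s)_i is a convex combination of those y_{ij} that lie in the convex set
  C_i(x(s)_{-i}).
*)
theory Submission
  imports Defs
begin

section \<open>Brouwer's fixed point theorem on cubes with a finite set of coordinates\<close>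

text \<open>The coordinates form a set, not a type, since their number will depend on finite covers
  found inside a proof. Pinning the remaining coordinates to 0 keeps the cube compact in the full
  function space.\<close>

definition unit_cube :: "'i set \<Rightarrow> ('i \<Rightarrow> real) set" where
  "unit_cube I = {x. \<forall>i. x i \<in> (if i \<in> I then {0..1} else {0})}"

lemma unit_cube_nonneg: "x \<in> unit_cube I \<Longrightarrow> 0 \<le> x i"
  by (cases "i \<in> I") (auto simp: unit_cube_def dest: spec[of _ i])

lemma compact_unit_cube: "compact (unit_cube I)"
proof -
  have "compactin (product_topology (\<lambda>_. euclideanreal) UNIV)
          (PiE UNIV (\<lambda>i. if i \<in> I then {0..1} else {0}))"
    by (simp add: compactin_PiE)
  moreover have "PiE UNIV (\<lambda>i. if i \<in> I then {0..1} else {0}) = unit_cube I"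
    by (auto simp: unit_cube_def PiE_def Pi_def)
  ultimately show ?thesis
    by (simp add: euclidean_product_topology)
qed

lemma tendsto_fun_iff:
  fixes f :: "'a \<Rightarrow> 'i \<Rightarrow> 'b::topological_space"
  shows "(f \<longlongrightarrow> l) F \<longleftrightarrow> (\<forall>i. ((\<lambda>k. f k i) \<longlongrightarrow> l i) F)"
  using limitin_componentwise[of "\<lambda>_. euclidean" UNIV f l F]
  by (simp add: euclidean_product_topology)

text \<open>Kuhn's combinatorial lemma on the grid of mesh \<open>1 / p\<close>: each grid point is
  labelled, coordinate by coordinate, according to whether \<open>f\<close> moves it up or down, and
  some cell carries both labels in every coordinate. The corners \<open>r\<close> and
  \<open>s\<close> depend on \<open>i\<close>; only the base corner \<open>a\<close> is common to
  all coordinates.\<close>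

lemma kuhn_approximate_fixed_point:
  fixes f :: "(nat \<Rightarrow> real) \<Rightarrow> nat \<Rightarrow> real"
  assumes f01: "\<And>x i. x \<in> unit_cube {..<n} \<Longrightarrow> i < n \<Longrightarrow> f x i \<in> {0..1}"
    and p: "0 < p"
  obtains a where "a \<in> unit_cube {..<n}"
    and "\<And>i. i < n \<Longrightarrow> \<exists>r\<in>unit_cube {..<n}. \<exists>s\<in>unit_cube {..<n}.
           (\<forall>j. \<bar>r j - a j\<bar> \<le> 1 / real p \<and> \<bar>s j - a j\<bar> \<le> 1 / real p)
           \<and> r i \<le> f r i \<and> f s i \<le> s i"
proof -
  define pt where "pt x = (\<lambda>i. if i < n then real (x i) / real p else 0)" for x :: "nat \<Rightarrow> nat"
  \<comment> \<open>The labels on the faces \<open>x i = 0\<close> and \<open>x i = p\<close> are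
    forced by \<open>kuhn_lemma\<close>. They agree with the direction of \<open>f\<close> because
    its values lie between 0 and 1.\<close>
  define label where "label x i =
    (if x i = 0 then 0 else if x i = p then 1 else if pt x i \<le> f (pt x) i then 0 else (1::nat))"
    for x i
  have pt: "pt x \<in> unit_cube {..<n}" if "\<forall>i<n. x i \<le> p" for x
    using that p by (auto simp: pt_def unit_cube_def)
  have label0: "pt x i \<le> f (pt x) i" if "\<forall>i<n. x i \<le> p" "i < n" "label x i = 0" for x i
    using that f01[OF pt[OF that(1)] that(2)] p
    by (auto simp: label_def pt_def split: if_splits)
  have label1: "f (pt x) i \<le> pt x i" if "\<forall>i<n. x i \<le> p" "i < n" "label x i = 1" for x i
    using that f01[OF pt[OF that(1)] that(2)] p
    by (auto simp: label_def pt_def split: if_splits)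
  obtain q where q: "\<forall>i<n. q i < p"
    and rs: "\<forall>i<n. \<exists>r s. (\<forall>j<n. q j \<le> r j \<and> r j \<le> q j + 1) \<and>
               (\<forall>j<n. q j \<le> s j \<and> s j \<le> q j + 1) \<and> label r i \<noteq> label s i"
    by (rule kuhn_lemma[OF p, of n label]) (use p in \<open>auto simp: label_def\<close>)
  have near: "\<bar>pt r j - pt q j\<bar> \<le> 1 / real p"
    if "\<forall>j<n. q j \<le> r j \<and> r j \<le> q j + 1" for r j
  proof (cases "j < n")
    case True
    then have "real (q j) \<le> real (r j)" "real (r j) \<le> real (q j) + 1"
      using that by (force)+
    then show ?thesis
      using True p by (simp add: pt_def divide_right_mono flip: diff_divide_distrib)
  qed (simp add: pt_def)
  \<comment> \<open>The strict inequality \<open>q i < p\<close> leaves room for the opposite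
    corners, so the whole cell lies in the grid.\<close>
  have bound: "\<forall>j<n. r j \<le> p" if "\<forall>j<n. q j \<le> r j \<and> r j \<le> q j + 1" for r
    using that q by (metis Suc_eq_plus1 Suc_leI order_trans)
  show thesis
  proof (rule that[of "pt q"])
    show "pt q \<in> unit_cube {..<n}"
      using q by (intro pt) (auto intro: less_imp_le)
    fix i assume i: "i < n"
    then obtain r s where r: "\<forall>j<n. q j \<le> r j \<and> r j \<le> q j + 1"
      and s: "\<forall>j<n. q j \<le> s j \<and> s j \<le> q j + 1" and neq: "label r i \<noteq> label s i"
      using rs by blast
    have "label x i = 0 \<or> label x i = 1" for x
      by (simp add: label_def)
    then consider "label r i = 0" "label s i = 1" | "label s i = 0" "label r i = 1"
      using neq by metis
    then show "\<exists>r\<in>unit_cube {..<n}. \<exists>s\<in>unit_cube {..<n}.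
           (\<forall>j. \<bar>r j - pt q j\<bar> \<le> 1 / real p \<and> \<bar>s j - pt q j\<bar> \<le> 1 / real p)
           \<and> r i \<le> f r i \<and> f s i \<le> s i"
    proof cases
      case 1
      then show ?thesis
        using near r s bound[OF r] bound[OF s] pt label0 label1 i
        by (intro bexI[of _ "pt r"] bexI[of _ "pt s"]) auto
    next
      case 2
      then show ?thesis
        using near r s bound[OF r] bound[OF s] pt label0 label1 i
        by (intro bexI[of _ "pt s"] bexI[of _ "pt r"]) auto
    qed
  qed
qed

text \<open>Cells of mesh tending to 0 have a subsequence converging to some \<open>l\<close> by
  compactness. For each coordinate the two corners converge to the same \<open>l\<close>, and their
  opposite inequalities become an equality in the limit.\<close>

lemma brouwer_unit_cube_nat:
  fixes f :: "(nat \<Rightarrow> real) \<Rightarrow> nat \<Rightarrow> real"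
  assumes cont: "\<And>i. i < n \<Longrightarrow> continuous_on (unit_cube {..<n}) (\<lambda>x. f x i)"
    and f01: "\<And>x i. x \<in> unit_cube {..<n} \<Longrightarrow> i < n \<Longrightarrow> f x i \<in> {0..1}"
  shows "\<exists>x\<in>unit_cube {..<n}. \<forall>i<n. f x i = x i"
proof -
  let ?Q = "unit_cube {..<n}"
  have "\<exists>a. a \<in> ?Q \<and> (\<forall>i<n. \<exists>r\<in>?Q. \<exists>s\<in>?Q.
      (\<forall>j. \<bar>r j - a j\<bar> \<le> 1 / real (Suc k) \<and> \<bar>s j - a j\<bar> \<le> 1 / real (Suc k))
      \<and> r i \<le> f r i \<and> f s i \<le> s i)" for k
    by (rule kuhn_approximate_fixed_point[of n f "Suc k"]) (use f01 in auto)
  then obtain a where aQ: "\<And>k. a k \<in> ?Q"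
    and a: "\<And>k i. i < n \<Longrightarrow> \<exists>r\<in>?Q. \<exists>s\<in>?Q.
      (\<forall>j. \<bar>r j - a k j\<bar> \<le> 1 / real (Suc k) \<and> \<bar>s j - a k j\<bar> \<le> 1 / real (Suc k))
      \<and> r i \<le> f r i \<and> f s i \<le> s i"
    by metis
  obtain l \<phi> where l: "l \<in> ?Q" and \<phi>: "strict_mono \<phi>" and lim: "(a \<circ> \<phi>) \<longlonglongrightarrow> l"
    using compact_unit_cube[of "{..<n}"] aQ unfolding compact_eq_seq_compact_metric
    by (metis seq_compactE)
  have small: "(\<lambda>k. 1 / real (Suc (\<phi> k))) \<longlonglongrightarrow> 0"
    using LIMSEQ_subseq_LIMSEQ[OF LIMSEQ_inverse_real_of_nat \<phi>]
    by (simp add: o_def divide_inverse)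
  \<comment> \<open>Every sequence that stays within the shrinking cells inherits the limit of the
    base corners.\<close>
  have lim': "r \<longlonglongrightarrow> l" if "\<And>k j. \<bar>r k j - a (\<phi> k) j\<bar> \<le> 1 / real (Suc (\<phi> k))"
    for r :: "nat \<Rightarrow> nat \<Rightarrow> real"
    unfolding tendsto_fun_iff
  proof
    fix j
    have "(\<lambda>k. r k j - a (\<phi> k) j) \<longlonglongrightarrow> 0"
      using that by (intro Lim_null_comparison[OF _ small]) auto
    moreover have "(\<lambda>k. a (\<phi> k) j) \<longlonglongrightarrow> l j"
      using lim unfolding tendsto_fun_iff by (simp add: o_def)
    ultimately have "(\<lambda>k. (r k j - a (\<phi> k) j) + a (\<phi> k) j) \<longlonglongrightarrow> 0 + l j"
      by (rule tendsto_add)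
    then show "(\<lambda>k. r k j) \<longlonglongrightarrow> l j" by simp
  qed
  have "f l i = l i" if i: "i < n" for i
  proof -
    have "\<forall>k. \<exists>r s. r \<in> ?Q \<and> s \<in> ?Q \<and> (\<forall>j. \<bar>r j - a (\<phi> k) j\<bar> \<le> 1 / real (Suc (\<phi> k)))
        \<and> (\<forall>j. \<bar>s j - a (\<phi> k) j\<bar> \<le> 1 / real (Suc (\<phi> k))) \<and> r i \<le> f r i \<and> f s i \<le> s i"
      using a[OF i] by blast
    then obtain r s where rs: "\<And>k. r k \<in> ?Q" "\<And>k. s k \<in> ?Q"
      "\<And>k j. \<bar>r k j - a (\<phi> k) j\<bar> \<le> 1 / real (Suc (\<phi> k))"
      "\<And>k j. \<bar>s k j - a (\<phi> k) j\<bar> \<le> 1 / real (Suc (\<phi> k))"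
      "\<And>k. r k i \<le> f (r k) i" "\<And>k. f (s k) i \<le> s k i"
      by metis
    have r: "r \<longlonglongrightarrow> l" and s: "s \<longlonglongrightarrow> l"
      using rs by (auto intro!: lim')
    have fr: "(\<lambda>k. f (r k) i) \<longlonglongrightarrow> f l i" and fs: "(\<lambda>k. f (s k) i) \<longlonglongrightarrow> f l i"
      using continuous_on_tendsto_compose[OF cont[OF i] r l]
        continuous_on_tendsto_compose[OF cont[OF i] s l] rs by auto
    have "l i \<le> f l i"
      using r fr rs(5) unfolding tendsto_fun_iff by (blast intro: LIMSEQ_le)
    moreover have "f l i \<le> l i"
      using s fs rs(6) unfolding tendsto_fun_iff by (blast intro: LIMSEQ_le)
    ultimately show ?thesis by simp
  qed
  with l show ?thesis by blast
qed

text \<open>Transport of the previous result along an enumeration of \<open>I\<close>; later the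
  coordinates are pairs of a player and a point of a finite cover.\<close>

theorem brouwer_unit_cube:
  fixes f :: "('i \<Rightarrow> real) \<Rightarrow> 'i \<Rightarrow> real"
  assumes "finite I"
    and cont: "\<And>i. i \<in> I \<Longrightarrow> continuous_on (unit_cube I) (\<lambda>x. f x i)"
    and f01: "\<And>x i. x \<in> unit_cube I \<Longrightarrow> i \<in> I \<Longrightarrow> f x i \<in> {0..1}"
  shows "\<exists>x\<in>unit_cube I. \<forall>i\<in>I. f x i = x i"
proof -
  obtain h where h: "bij_betw h {..<card I} I"
    using ex_bij_betw_nat_finite[OF \<open>finite I\<close>] by (auto simp: atLeast0LessThan)
  define g where "g = the_inv_into {..<card I} h"
  have g: "g i < card I" "h (g i) = i" if "i \<in> I" for i
    using that h bij_betw_the_inv_into[OF h] f_the_inv_into_f_bij_betw[OF h]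
    by (auto simp: g_def bij_betw_def)
  have hI: "h k \<in> I" "g (h k) = k" if "k < card I" for k
    using that h by (auto simp: g_def bij_betw_def the_inv_into_f_f)
  define e where "e x = (\<lambda>i. if i \<in> I then x (g i) else 0)" for x :: "nat \<Rightarrow> real"
  have e: "e x \<in> unit_cube I" if "x \<in> unit_cube {..<card I}" for x
    using that g(1) by (auto simp: e_def unit_cube_def) (metis lessThan_iff atLeastAtMost_iff)+
  have conte: "continuous_on A e" for A
  proof (rule continuous_on_coordinatewise_then_product)
    show "continuous_on A (\<lambda>x. e x i)" for i
      unfolding e_def by (cases "i \<in> I") (auto intro: continuous_on_product_then_coordinatewise)
  qed
  have "\<exists>x\<in>unit_cube {..<card I}. \<forall>k<card I. f (e x) (h k) = x k"
  proof (rule brouwer_unit_cube_nat)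
    show "continuous_on (unit_cube {..<card I}) (\<lambda>x. f (e x) (h k))" if "k < card I" for k
      using continuous_on_compose2[OF cont[OF hI(1)[OF that]] conte] e by blast
  qed (use f01 e hI in auto)
  then obtain x where x: "x \<in> unit_cube {..<card I}" "\<forall>k<card I. f (e x) (h k) = x k"
    by blast
  have "f (e x) i = e x i" if "i \<in> I" for i
    using x(2) g[OF that] that by (metis e_def)
  with e[OF x(1)] show ?thesis by blast
qed

section \<open>Partitions of unity and weights in a simplex\<close>

text \<open>The distances to the complements of the \<open>V j\<close>, divided by their sum, do the
  job: each is positive exactly on \<open>V j\<close>, and the covering makes the sum
  positive.\<close>

lemma partition_of_unity_finite_cover:
  fixes S :: "'a::metric_space set"
  assumes "closed S" "finite J"
    and V: "\<And>j. j \<in> J \<Longrightarrow> openin (top_of_set S) (V j)"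
    and cover: "S \<subseteq> (\<Union>j\<in>J. V j)"
  shows "\<exists>w :: 'j \<Rightarrow> 'a \<Rightarrow> real. (\<forall>j\<in>J. continuous_on S (w j)) \<and> (\<forall>x\<in>S. (\<Sum>j\<in>J. w j x) = 1) \<and>
           (\<forall>x\<in>S. \<forall>j\<in>J. 0 \<le> w j x \<and> (0 < w j x \<longrightarrow> x \<in> V j))"
proof -
  \<comment> \<open>The distance to the empty set is 0 by convention, which would give no weight to
    a \<open>V j\<close> that is all of \<open>S\<close>; hence the separate value 1.\<close>
  define d where "d j x = (if S \<subseteq> V j then 1 else infdist x (S - V j))" for j x
  have closed: "closed (S - V j)" if "j \<in> J" for j
    using V[OF that] \<open>closed S\<close>
    by (metis closedin_closed_trans closedin_diff closedin_topspace topspace_euclidean_subtopology)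
  have contd: "continuous_on S (d j)" for j
    unfolding d_def by (cases "S \<subseteq> V j") (simp_all add: continuous_on_infdist)
  have d0: "0 \<le> d j x" for j x
    by (simp add: d_def infdist_nonneg)
  have dpos: "0 < d j x \<longleftrightarrow> x \<in> V j" if "x \<in> S" "j \<in> J" for j x
  proof (cases "S \<subseteq> V j")
    case False
    then show ?thesis
      using in_closed_iff_infdist_zero[OF closed[OF that(2)], of x] infdist_nonneg[of x "S - V j"] that
      by (auto simp: d_def order.strict_iff_order)
  qed (use that in \<open>auto simp: d_def\<close>)
  have pos: "0 < (\<Sum>j\<in>J. d j x)" if x: "x \<in> S" for x
  proof -
    obtain j where "j \<in> J" "x \<in> V j" using cover x by blast
    then show ?thesis
      using dpos x d0 \<open>finite J\<close> by (intro sum_pos2[of J j]) auto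
  qed
  show ?thesis
  proof (intro exI[of _ "\<lambda>j x. d j x / (\<Sum>j\<in>J. d j x)"] conjI ballI impI)
    show "continuous_on S (\<lambda>x. d j x / (\<Sum>j\<in>J. d j x))" for j
      using pos by (intro continuous_intros contd) (metis less_irrefl)
    show "0 \<le> d j x / (\<Sum>j\<in>J. d j x)" for j x
      by (simp add: d0 sum_nonneg)
    show "(\<Sum>j\<in>J. d j x / (\<Sum>j\<in>J. d j x)) = 1" if "x \<in> S" for x
      using pos[OF that] by (simp flip: sum_divide_distrib)
    show "x \<in> V j" if "x \<in> S" "j \<in> J" "0 < d j x / (\<Sum>j\<in>J. d j x)" for j x
      using that pos[OF that(1)] dpos[OF that(1,2)] by (simp add: zero_less_divide_iff)
  qed
qed

text \<open>On nonnegative \<open>t\<close> this is a retraction onto the standard simplex: a total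
  below 1 is topped up evenly, a total above 1 is scaled down. The two maxima join both cases in one
  continuous formula.\<close>

definition simplex_retraction :: "'j set \<Rightarrow> ('j \<Rightarrow> real) \<Rightarrow> 'j \<Rightarrow> real" where
  "simplex_retraction J t j = (t j + max 0 (1 - sum t J) / real (card J)) / max 1 (sum t J)"

lemma simplex_retraction_nonneg:
  "0 \<le> t j \<Longrightarrow> 0 \<le> simplex_retraction J t j"
  by (simp add: simplex_retraction_def)

lemma sum_simplex_retraction:
  assumes "finite J" "J \<noteq> {}"
  shows "(\<Sum>j\<in>J. simplex_retraction J t j) = 1"
proof -
  have "(\<Sum>j\<in>J. t j + max 0 (1 - sum t J) / real (card J)) = max 1 (sum t J)"
    using assms by (simp add: sum.distrib card_gt_0_iff max_def)
  then show ?thesis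
    by (simp add: simplex_retraction_def flip: sum_divide_distrib)
qed

lemma simplex_retraction_id:
  "sum t J = 1 \<Longrightarrow> simplex_retraction J t j = t j"
  by (simp add: simplex_retraction_def)

lemma continuous_on_simplex_retraction:
  assumes "\<And>j. continuous_on S (\<lambda>s. t s j)"
  shows "continuous_on S (\<lambda>s. simplex_retraction J (t s) j)"
proof -
  have "continuous_on S (\<lambda>s. sum (t s) J)"
    using assms by (intro continuous_intros) auto
  then show ?thesis
    unfolding simplex_retraction_def using assms
    by (cases "card J = 0") (auto intro!: continuous_intros)
qed

section \<open>Convex combinations in a topological vector space with explicit carrier\<close>

lemma real_ring_simps [simp]:
  "carrier real_ring = UNIV" "\<zero>\<^bsub>real_ring\<^esub> = 0" "\<one>\<^bsub>real_ring\<^esub> = 1"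
  "a \<oplus>\<^bsub>real_ring\<^esub> b = a + b" "a \<otimes>\<^bsub>real_ring\<^esub> b = a * b"
  by (simp_all add: real_ring_def)

text \<open>Induction from the two-point definition of convexity: one point is split off and the
  other weights are rescaled by their sum \<open>r\<close>. Points of weight 0 need only lie in the
  carrier, as the final step combines points of which only those with positive weight are known to
  lie in the section.\<close>

lemma convex_in_finsum:
  assumes "Module.module real_ring E" and S: "convex_in E S"
    and "finite J" "\<And>j. j \<in> J \<Longrightarrow> 0 \<le> w j" "sum w J = 1"
    and "\<And>j. j \<in> J \<Longrightarrow> y j \<in> carrier E"
    and "\<And>j. j \<in> J \<Longrightarrow> 0 < w j \<Longrightarrow> y j \<in> S"
  shows "(\<Oplus>\<^bsub>E\<^esub>j\<in>J. w j \<odot>\<^bsub>E\<^esub> y j) \<in> S"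
  using assms(3-)
proof (induction J arbitrary: w rule: finite_induct)
  case (insert a F)
  interpret module real_ring E by fact
  have SE: "S \<subseteq> carrier E" using S by (simp add: convex_in_def)
  have smult: "c \<odot>\<^bsub>E\<^esub> v \<in> carrier E" if "v \<in> carrier E" for c v
    using smult_closed[of c v] that by simp
  have y: "y a \<in> carrier E" "y \<in> F \<rightarrow> carrier E" using insert.prems by auto
  define P where "P = (\<Oplus>\<^bsub>E\<^esub>j\<in>F. w j \<odot>\<^bsub>E\<^esub> y j)"
  define r where "r = sum w F"
  have r: "w a + r = 1" "0 \<le> r"
    using insert by (auto simp: r_def intro: sum_nonneg)
  have eq: "(\<Oplus>\<^bsub>E\<^esub>j\<in>insert a F. w j \<odot>\<^bsub>E\<^esub> y j) = w a \<odot>\<^bsub>E\<^esub> y a \<oplus>\<^bsub>E\<^esub> P"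
    using insert.hyps y smult unfolding P_def by (subst M.finsum_insert) auto
  show ?case
  \<comment> \<open>Rescaling is impossible for \<open>r = 0\<close>, but then all the weight sits
    on \<open>y a\<close>.\<close>
  proof (cases "r = 0")
    case True
    then have "w j = 0" if "j \<in> F" for j
      using insert.hyps insert.prems(1) that by (simp add: r_def sum_nonneg_eq_0_iff)
    then have "P = \<zero>\<^bsub>E\<^esub>"
      unfolding P_def using y smult_l_null by (intro M.add.finprod_one_eqI) auto
    then show ?thesis
      using eq True r y smult_one[of "y a"] insert.prems(4) by simp
  next
    case False
    define v where "v = (\<Oplus>\<^bsub>E\<^esub>j\<in>F. (w j / r) \<odot>\<^bsub>E\<^esub> y j)"
    have v: "v \<in> S"
      unfolding v_def using False r insert.prems
      by (intro insert.IH) (auto simp: r_def zero_less_divide_iff simp flip: sum_divide_distrib)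
    have "r \<odot>\<^bsub>E\<^esub> v = (\<Oplus>\<^bsub>E\<^esub>j\<in>F. r \<odot>\<^bsub>E\<^esub> ((w j / r) \<odot>\<^bsub>E\<^esub> y j))"
      unfolding v_def using insert.hyps y smult by (subst finsum_smult_ldistr) auto
    also have "\<dots> = P"
      unfolding P_def
    proof (rule M.finsum_cong')
      show "r \<odot>\<^bsub>E\<^esub> ((w j / r) \<odot>\<^bsub>E\<^esub> y j) = w j \<odot>\<^bsub>E\<^esub> y j" if "j \<in> F" for j
        using smult_assoc1[of r "w j / r" "y j"] y False that by (auto simp: Pi_iff)
    qed (use y smult in auto)
    finally have P: "P = r \<odot>\<^bsub>E\<^esub> v" ..
    show ?thesis
    \<comment> \<open>With weight 0 the point \<open>y a\<close> may lie outside \<open>S\<close>,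
      so convexity cannot be applied; here \<open>r = 1\<close> and the sum is \<open>v\<close>
      itself.\<close>
    proof (cases "w a = 0")
      case True
      then have "w a \<odot>\<^bsub>E\<^esub> y a \<oplus>\<^bsub>E\<^esub> P = v"
        using P r v SE y smult_l_null[of "y a"] smult_one[of v] by auto
      then show ?thesis
        using eq v by simp
    next
      case False
      then have "y a \<in> S" "0 \<le> w a"
        using insert.prems(1,4)[of a] by auto
      then show ?thesis
        using eq P v r S unfolding convex_in_def by auto
    qed
  qed
qed simp

text \<open>The points are fixed and only the weights vary, so joint continuity of the two vector
  space operations suffices, one summand at a time.\<close>

lemma continuous_map_finsum:
  assumes E: "hausdorff_tvs E T"
    and "finite J"
    and "\<And>j. j \<in> J \<Longrightarrow> y j \<in> carrier E"
    and "\<And>j. j \<in> J \<Longrightarrow> continuous_map Z euclideanreal (w j)"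
  shows "continuous_map Z T (\<lambda>s. \<Oplus>\<^bsub>E\<^esub>j\<in>J. w j s \<odot>\<^bsub>E\<^esub> y j)"
  using assms(2-)
proof (induction J rule: finite_induct)
  case empty
  interpret module real_ring E using E by (simp add: hausdorff_tvs_def)
  show ?case
    using E by (simp add: hausdorff_tvs_def)
next
  case (insert a F)
  interpret module real_ring E using E by (simp add: hausdorff_tvs_def)
  have smult: "c \<odot>\<^bsub>E\<^esub> v \<in> carrier E" if "v \<in> carrier E" for c v
    using smult_closed[of c v] that by simp
  have T: "topspace T = carrier E"
    and add: "continuous_map (prod_topology T T) T (\<lambda>(x, y). x \<oplus>\<^bsub>E\<^esub> y)"
    and sc: "continuous_map (prod_topology euclideanreal T) T (\<lambda>(a, x). a \<odot>\<^bsub>E\<^esub> x)"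
    using E by (auto simp: hausdorff_tvs_def)
  have "continuous_map Z (prod_topology euclideanreal T) (\<lambda>s. (w a s, y a))"
    using insert.prems T by (auto simp: continuous_map_pairedI)
  then have 1: "continuous_map Z T (\<lambda>s. w a s \<odot>\<^bsub>E\<^esub> y a)"
    using continuous_map_compose[OF _ sc] by (fastforce simp: o_def)
  have "continuous_map Z (prod_topology T T)
          (\<lambda>s. (w a s \<odot>\<^bsub>E\<^esub> y a, \<Oplus>\<^bsub>E\<^esub>j\<in>F. w j s \<odot>\<^bsub>E\<^esub> y j))"
    using insert 1 by (intro continuous_map_pairedI) auto
  then have "continuous_map Z T (\<lambda>s. w a s \<odot>\<^bsub>E\<^esub> y a \<oplus>\<^bsub>E\<^esub> (\<Oplus>\<^bsub>E\<^esub>j\<in>F. w j s \<odot>\<^bsub>E\<^esub> y j))"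
    using continuous_map_compose[OF _ add] by (fastforce simp: o_def)
  moreover have "(\<Oplus>\<^bsub>E\<^esub>j\<in>insert a F. w j s \<odot>\<^bsub>E\<^esub> y j)
      = w a s \<odot>\<^bsub>E\<^esub> y a \<oplus>\<^bsub>E\<^esub> (\<Oplus>\<^bsub>E\<^esub>j\<in>F. w j s \<odot>\<^bsub>E\<^esub> y j)" for s
    using insert.hyps insert.prems(1) smult by (subst M.finsum_insert) auto
  ultimately show ?case by simp
qed

section \<open>Existence of an equilibrium in choice\<close>

theorem theorem6:
  fixes n :: nat
    and E :: "nat \<Rightarrow> (real, 'e) module"
    and T :: "nat \<Rightarrow> 'e topology"
    and X :: "nat \<Rightarrow> 'e set"
    and C :: "nat \<Rightarrow> (nat \<Rightarrow> 'e) set"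
  defines "N \<equiv> {1..n}"
  assumes game: "game_in_choice_form N X C"
    and some_choice: "\<And>x. x \<in> profiles N X \<Longrightarrow>
          \<exists>i\<in>N. upper_section X C i (others N i x) \<noteq> {}"
    and a_space: "\<And>i. i \<in> N \<Longrightarrow> hausdorff_tvs (E i) (T i)"
    and a_sets: "\<And>i. i \<in> N \<Longrightarrow>
          X i \<noteq> {} \<and> convex_in (E i) (X i) \<and> compactin (T i) (X i) \<and> C i \<noteq> {}"
    and b: "\<And>i. i \<in> N \<Longrightarrow>
          \<exists>U. (\<forall>y\<in>X i. openin (partial_profile_topology N X T i) (U y) \<and>
                       U y \<subseteq> {z \<in> partial_profiles N X i. y \<in> upper_section X C i z}) \<and>
              (\<Union>y\<in>X i. U y) = partial_profiles N X i"
    and c: "\<And>i z. i \<in> N \<Longrightarrow> z \<in> partial_profiles N X i \<Longrightarrow>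
          convex_in (E i) (upper_section X C i z) \<or> upper_section X C i z = {}"
  shows "\<exists>x. equilibrium_in_choice N X C x"
proof -
  have finN: "finite N" by (simp add: N_def)
  have module: "Module.module real_ring (E i)" if "i \<in> N" for i
    using a_space[OF that] by (auto simp: hausdorff_tvs_def)
  have XE: "X i \<subseteq> carrier (E i)" if "i \<in> N" for i
    using a_sets[OF that] by (auto simp: convex_in_def)
  have compact_others: "compactin (partial_profile_topology N X T i) (partial_profiles N X i)" for i
    unfolding partial_profile_topology_def partial_profiles_def
    using a_sets by (auto simp: compactin_PiE compactin_subtopology)

  \<comment> \<open>A finite subcover is numbered by \<open>j < m i\<close>, so that pairs of
    natural numbers can index one cube for all players.\<close>
  have "\<forall>i\<in>N. \<exists>m y V. partial_profiles N X i \<subseteq> (\<Union>j<m::nat. V j) \<and>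
          (\<forall>j<m. y j \<in> X i \<and> openin (partial_profile_topology N X T i) (V j) \<and>
                 (\<forall>z\<in>V j. y j \<in> upper_section X C i z))"
  proof
    fix i assume i: "i \<in> N"
    obtain U where U: "\<forall>y\<in>X i. openin (partial_profile_topology N X T i) (U y) \<and>
          U y \<subseteq> {z \<in> partial_profiles N X i. y \<in> upper_section X C i z}"
      and cover: "(\<Union>y\<in>X i. U y) = partial_profiles N X i"
      using b[OF i] by blast
    obtain \<F> where \<F>: "finite \<F>" "\<F> \<subseteq> U ` X i" "partial_profiles N X i \<subseteq> \<Union>\<F>"
      using compactinD[OF compact_others[of i], of "U ` X i"] U cover by blast
    obtain Y where Y: "finite Y" "Y \<subseteq> X i" "\<F> = U ` Y"
      using finite_subset_image[OF \<F>(1,2)] by blast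
    obtain h where h: "bij_betw h {..<card Y} Y"
      using ex_bij_betw_nat_finite[OF Y(1)] by (auto simp: atLeast0LessThan)
    have hY: "h ` {..<card Y} = Y"
      using h by (simp add: bij_betw_def)
    show "\<exists>m y V. partial_profiles N X i \<subseteq> (\<Union>j<m::nat. V j) \<and>
          (\<forall>j<m. y j \<in> X i \<and> openin (partial_profile_topology N X T i) (V j) \<and>
                 (\<forall>z\<in>V j. y j \<in> upper_section X C i z))"
    proof (intro exI[of _ "card Y"] exI[of _ h] exI[of _ "U \<circ> h"] conjI allI impI)
      show "partial_profiles N X i \<subseteq> (\<Union>j<card Y. (U \<circ> h) j)"
        using \<F>(3) Y(3) hY by (metis image_comp)
      fix j assume "j < card Y"
      then have "h j \<in> X i" using hY Y(2) by blast
      then show "h j \<in> X i" "openin (partial_profile_topology N X T i) ((U \<circ> h) j)"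
        "\<forall>z\<in>(U \<circ> h) j. h j \<in> upper_section X C i z"
        using U by auto
    qed
  qed
  then obtain m y V where mV: "\<forall>i\<in>N. partial_profiles N X i \<subseteq> (\<Union>j<m i::nat. V i j) \<and>
          (\<forall>j<m i. y i j \<in> X i \<and> openin (partial_profile_topology N X T i) (V i j) \<and>
                 (\<forall>z\<in>V i j. y i j \<in> upper_section X C i z))"
    unfolding bchoice_iff by blast
  have cover: "partial_profiles N X i \<subseteq> (\<Union>j<m i. V i j)" if "i \<in> N" for i
    using mV that by blast
  have y: "y i j \<in> X i"
    and V: "openin (partial_profile_topology N X T i) (V i j)"
    and Vy: "\<And>z. z \<in> V i j \<Longrightarrow> y i j \<in> upper_section X C i z"
    if "i \<in> N" "j < m i" for i j
    using mV that by blast+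
  have yE: "y i j \<in> carrier (E i)" if "i \<in> N" "j < m i" for i j
    using y XE that by blast
  \<comment> \<open>At least one point per player is required for the retracted weights to sum to
    1.\<close>
  have m: "{..<m i} \<noteq> {}" if "i \<in> N" for i
  proof -
    have "partial_profiles N X i \<noteq> {}"
      using a_sets by (auto simp: partial_profiles_def PiE_eq_empty_iff)
    then show ?thesis using cover[OF that] by auto
  qed

  define I where "I = Sigma N (\<lambda>i. {..<m i})"
  define Q where "Q = unit_cube I"
  have finI: "finite I" using finN by (simp add: I_def)
  have Q0: "0 \<le> s p" if "s \<in> Q" for s p
    using that by (simp add: Q_def unit_cube_nonneg)
  \<comment> \<open>The coordinates of \<open>s\<close> belonging to one player need not sum to 1;
    the retraction makes \<open>x s\<close> a profile for every \<open>s\<close> in the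
    cube.\<close>
  define x where "x s = (\<lambda>i\<in>N. \<Oplus>\<^bsub>E i\<^esub>j\<in>{..<m i}.
      simplex_retraction {..<m i} (\<lambda>j. s (i, j)) j \<odot>\<^bsub>E i\<^esub> y i j)" for s
  have xX: "x s i \<in> X i" if "s \<in> Q" "i \<in> N" for s i
    unfolding x_def using that y yE a_sets m Q0 module
    by (auto intro!: convex_in_finsum simplex_retraction_nonneg sum_simplex_retraction)
  have contx: "continuous_map (top_of_set Q) (subtopology (T i) (X i)) (\<lambda>s. x s i)"
    if "i \<in> N" for i
  proof -
    have "continuous_on Q (\<lambda>s. simplex_retraction {..<m i} (\<lambda>j. s (i, j)) j)" for j
      by (intro continuous_on_simplex_retraction)
        (rule continuous_on_product_then_coordinatewise[OF continuous_on_id])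
    then have "continuous_map (top_of_set Q) (T i) (\<lambda>s. x s i)"
      unfolding x_def using that yE a_space
      by (auto intro!: continuous_map_finsum)
    then show ?thesis
      using xX that by (auto simp: continuous_map_in_subtopology)
  qed
  have conto: "continuous_map (top_of_set Q) (partial_profile_topology N X T i)
      (\<lambda>s. others N i (x s))" for i
    unfolding partial_profile_topology_def others_def
    by (intro continuous_map_coordinatewise_then_product) (auto intro: contx)

  have "\<forall>i\<in>N. \<exists>w :: nat \<Rightarrow> _ \<Rightarrow> real.
          (\<forall>j<m i. continuous_on Q (w j)) \<and> (\<forall>s\<in>Q. (\<Sum>j<m i. w j s) = 1) \<and>
          (\<forall>s\<in>Q. \<forall>j<m i. 0 \<le> w j s \<and> (0 < w j s \<longrightarrow> others N i (x s) \<in> V i j))"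
  proof
    fix i assume i: "i \<in> N"
    let ?W = "\<lambda>j. {s \<in> Q. others N i (x s) \<in> V i j}"
    \<comment> \<open>The partition lemma asks for a closed set in a metric space. The cube is one,
      whereas the partial profiles only carry an abstract topology.\<close>
    have clQ: "closed Q" by (simp add: Q_def compact_imp_closed compact_unit_cube)
    have opW: "openin (top_of_set Q) (?W j)" if "j \<in> {..<m i}" for j
      using openin_continuous_map_preimage[OF conto V[OF i]] that by simp
    have "others N i (x s) \<in> partial_profiles N X i" if "s \<in> Q" for s
      using xX that by (simp add: others_def partial_profiles_def)
    then have QW: "Q \<subseteq> (\<Union>j\<in>{..<m i}. ?W j)"
      using cover[OF i] by blast
    show "\<exists>w :: nat \<Rightarrow> _ \<Rightarrow> real.
          (\<forall>j<m i. continuous_on Q (w j)) \<and> (\<forall>s\<in>Q. (\<Sum>j<m i. w j s) = 1) \<and>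
          (\<forall>s\<in>Q. \<forall>j<m i. 0 \<le> w j s \<and> (0 < w j s \<longrightarrow> others N i (x s) \<in> V i j))"
      using partition_of_unity_finite_cover[OF clQ finite_lessThan opW QW] by (simp add: Ball_def)
  qed
  then obtain w :: "nat \<Rightarrow> nat \<Rightarrow> _ \<Rightarrow> real" where
    w: "\<forall>i\<in>N. (\<forall>j<m i. continuous_on Q (w i j)) \<and> (\<forall>s\<in>Q. (\<Sum>j<m i. w i j s) = 1) \<and>
          (\<forall>s\<in>Q. \<forall>j<m i. 0 \<le> w i j s \<and> (0 < w i j s \<longrightarrow> others N i (x s) \<in> V i j))"
    unfolding bchoice_iff by blast
  have contw: "continuous_on Q (w i j)" if "i \<in> N" "j < m i" for i j
    using w that by blast
  have sumw: "(\<Sum>j<m i. w i j s) = 1" if "i \<in> N" "s \<in> Q" for i s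
    using w that by blast
  have w0: "0 \<le> w i j s" and wV: "0 < w i j s \<Longrightarrow> others N i (x s) \<in> V i j"
    if "i \<in> N" "j < m i" "s \<in> Q" for i j s
    using w that by blast+
  have w1: "w i j s \<le> 1" if "i \<in> N" "j < m i" "s \<in> Q" for i j s
    using member_le_sum[of j "{..<m i}" "\<lambda>j. w i j s"] w0 sumw that by simp

  \<comment> \<open>The partition weights of all players together form a self-map of the
    cube.\<close>
  have "\<exists>s\<in>unit_cube I. \<forall>p\<in>I. (\<lambda>(i, j). w i j s) p = s p"
    by (rule brouwer_unit_cube[OF finI]) (use contw w0 w1 in \<open>auto simp: I_def Q_def\<close>)
  then obtain s where s: "s \<in> Q" and fixed: "\<And>i j. i \<in> N \<Longrightarrow> j < m i \<Longrightarrow> s (i, j) = w i j s"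
    by (force simp: Q_def I_def)
  have "x s i \<in> upper_section X C i (others N i (x s))" if i: "i \<in> N" for i
  proof -
    have others: "others N i (x s) \<in> partial_profiles N X i"
      using xX[OF s] by (simp add: others_def partial_profiles_def)
    \<comment> \<open>The covering rules out the empty alternative in \<open>c\<close>, leaving
      convexity.\<close>
    then have "upper_section X C i (others N i (x s)) \<noteq> {}"
      using cover[OF i] Vy[OF i] by blast
    then have conv: "convex_in (E i) (upper_section X C i (others N i (x s)))"
      using c[OF i others] by blast
    \<comment> \<open>At the fixed point the coordinates are partition weights, so the retraction
      leaves them unchanged.\<close>
    have "(\<Sum>j<m i. s (i, j)) = 1"
      using sumw[OF i s] fixed[OF i] by simp
    then have "x s i = (\<Oplus>\<^bsub>E i\<^esub>j\<in>{..<m i}. s (i, j) \<odot>\<^bsub>E i\<^esub> y i j)"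
      using i by (simp add: x_def simplex_retraction_id)
    \<comment> \<open>A positive weight puts the partial profile into \<open>V i j\<close>, and
      thereby \<open>y i j\<close> into the section.\<close>
    also have "\<dots> \<in> upper_section X C i (others N i (x s))"
      using module[OF i] conv sumw[OF i s] fixed[OF i] w0[OF i _ s] wV[OF i _ s] Vy[OF i] yE[OF i]
      by (intro convex_in_finsum) auto
    finally show ?thesis .
  qed
  moreover have "x s \<in> profiles N X"
    using xX[OF s] by (auto simp: profiles_def x_def PiE_def extensional_def)
  ultimately show ?thesis
    unfolding equilibrium_in_choice_def by blast
qed

end
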